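(* Let $\Sigma$ be a finite alphabet, let $e$ be a regular expression over $\Sigma$ and let $w\in\Sigma^*$. Then $e \Downarrow w$ (that is, $w$ matches $e$) if and only if there is a finite run of the EKW machine \[ \langle e \,;\, [\,] \,;\, w\rangle \to \cdots \to \langle \varepsilon \,;\, [\,] \,;\, \epsilon_{\mathrm{str}}\rangle , \] where $\epsilon_{\mathrm{str}}$ denotes the empty string.
   Context: Regular expressions over a finite alphabet $\Sigma$ are given by the grammar $e ::= \varepsilon \mid a \mid e^{*} \mid e_1 e_2 \mid e_1 \mid e_2$ with $a\in\Sigma$; here $\varepsilon$ is a regular-expression constant (distinct from the empty string $\epsilon_{\mathrm{str}}$), and $e_1e_2$ is sequential composition. Strings are finite words over $\Sigma$, with concatenation written by juxtaposition. The matching relation $e \Downarrow w$ is the least relation closed under the rules: $a \Downarrow a$; $\varepsilon \Downarrow \epsilon_{\mathrm{str}}$; if $e_1\Downarrow w_1$ and $e_2\Downarrow w_2$ then $(e_1e_2)\Downarrow (w_1w_2)$; $e^{*}\Downarrow \epsilon_{\mathrm{str}}$; if $e\Downarrow w_1$ and $e^{*}\Downarrow w_2$ then $e^{*}\Downarrow (w_1w_2)$; if $e_1\Downarrow w$ then $(e_1\mid e_2)\Downarrow w$; if $e_2\Downarrow w$ then $(e_1\mid e_2)\Downarrow w$. Lists: $h::t$ is the list with head $h$ and tail $t$, $[\,]$ is the empty list. The EKW machine has configurations $\langle e\,;\,k\,;\,w\rangle$ where $e$ is a regular expression, $k$ is a list of regular expressions (the continuation) and $w$ is a string. Its (non-deterministic)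 transitions are exactly: $\langle e_1\mid e_2;k;w\rangle\to\langle e_1;k;w\rangle$; $\langle e_1\mid e_2;k;w\rangle\to\langle e_2;k;w\rangle$; $\langle e_1e_2;k;w\rangle\to\langle e_1;e_2::k;w\rangle$; $\langle e^{*};k;w\rangle\to\langle e;e^{*}::k;w\rangle$; $\langle e^{*};k;w\rangle\to\langle \varepsilon;k;w\rangle$; $\langle a;k;a\,w\rangle\to\langle \varepsilon;k;w\rangle$ for $a\in\Sigma$; $\langle \varepsilon;e::k;w\rangle\to\langle e;k;w\rangle$. A run is a finite sequence of zero or more such transitions. *)

theory Defs
  imports Main
begin

text \<open>
  The letters of an expression are taken from a type; the regular expressions over an
  alphabet \<open>\<Sigma>\<close> are those \<open>e\<close> with \<open>atoms e \<subseteq> \<Sigma>\<close>, and the strings over \<open>\<Sigma>\<close> are \<open>lists \<Sigma>\<close>.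
  This way the empty alphabet is covered as well.
\<close>

datatype (atoms: 'a) rexp =
    Eps
  | Atom 'a
  | Star "'a rexp"
  | Seq "'a rexp" "'a rexp"
  | Alt "'a rexp" "'a rexp"

inductive matches :: "'a rexp \<Rightarrow> 'a list \<Rightarrow> bool" (infix \<open>\<Down>\<close> 50) where
  match_Atom: "Atom a \<Down> [a]"
| match_Eps: "Eps \<Down> []"
| match_Seq: "e1 \<Down> w1 \<Longrightarrow> e2 \<Down> w2 \<Longrightarrow> Seq e1 e2 \<Down> w1 @ w2"
| match_Star_Nil: "Star e \<Down> []"
| match_Star_step: "e \<Down> w1 \<Longrightarrow> Star e \<Down> w2 \<Longrightarrow> Star e \<Down> w1 @ w2"
| match_Alt1: "e1 \<Down> w \<Longrightarrow> Alt e1 e2 \<Down> w"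
| match_Alt2: "e2 \<Down> w \<Longrightarrow> Alt e1 e2 \<Down> w"

type_synonym 'a ekw_config = "'a rexp \<times> 'a rexp list \<times> 'a list"

inductive ekw_step :: "'a ekw_config \<Rightarrow> 'a ekw_config \<Rightarrow> bool" where
  step_Alt1: "ekw_step (Alt e1 e2, k, w) (e1, k, w)"
| step_Alt2: "ekw_step (Alt e1 e2, k, w) (e2, k, w)"
| step_Seq: "ekw_step (Seq e1 e2, k, w) (e1, e2 # k, w)"
| step_Star: "ekw_step (Star e, k, w) (e, Star e # k, w)"
| step_Star_Eps: "ekw_step (Star e, k, w) (Eps, k, w)"
| step_Atom: "ekw_step (Atom a, k, a # w) (Eps, k, w)"
| step_Eps: "ekw_step (Eps, e # k, w) (e, k, w)"

abbreviation ekw_run :: "'a ekw_config \<Rightarrow> 'a ekw_config \<Rightarrow> bool" where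
  "ekw_run \<equiv> ekw_step\<^sup>*\<^sup>*"

text \<open>
  Neither relation mentions \<open>\<Sigma>\<close>. Nothing is lost: every run from a configuration over \<open>\<Sigma>\<close>
  stays over \<open>\<Sigma>\<close>, and the premises of a matching rule use only letters of its conclusion.
\<close>

definition config_over :: "'a set \<Rightarrow> 'a ekw_config \<Rightarrow> bool" where
  "config_over \<Sigma> c \<longleftrightarrow>
     (case c of (e, k, w) \<Rightarrow> atoms e \<subseteq> \<Sigma> \<and> (\<forall>e'\<in>set k. atoms e' \<subseteq> \<Sigma>) \<and> w \<in> lists \<Sigma>)"

lemma ekw_step_config_over:
  "ekw_step c c' \<Longrightarrow> config_over \<Sigma> c \<Longrightarrow> config_over \<Sigma> c'"
  by (induction rule: ekw_step.induct) (auto simp: config_over_def)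

lemma ekw_run_config_over:
  "ekw_run c c' \<Longrightarrow> config_over \<Sigma> c \<Longrightarrow> config_over \<Sigma> c'"
  by (induction rule: rtranclp_induct) (auto intro: ekw_step_config_over)

end

theory Submission
  imports Defs
begin

text \<open>
  Completeness: a match of \<open>e\<close> against \<open>w\<close> drives the machine, under any continuation and with any
  remaining input, past \<open>w\<close>. Soundness: read a configuration \<open>\<langle>e; [e\<^sub>1, \<dots>, e\<^sub>n]; w\<rangle>\<close> as the claim
  that \<open>w\<close> matches \<open>e e\<^sub>1 \<dots> e\<^sub>n\<close>. This claim holds of the final configuration and is inherited
  backwards along every transition.
\<close>

lemma matches_Seq_iff: "Seq e1 e2 \<Down> w \<longleftrightarrow> (\<exists>w1 w2. w = w1 @ w2 \<and> e1 \<Down> w1 \<and> e2 \<Down> w2)"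
  by (subst matches.simps) auto

lemma matches_Eps_iff: "Eps \<Down> w \<longleftrightarrow> w = []"
  by (subst matches.simps) auto

lemma matches_imp_ekw_run:
  "e \<Down> w \<Longrightarrow> ekw_run (e, k, w @ v) (Eps, k, v)"
proof (induction arbitrary: k v rule: matches.induct)
  case (match_Atom a)
  show ?case by (auto intro: step_Atom)
next
  case (match_Eps)
  show ?case by simp
next
  case (match_Seq e1 w1 e2 w2)
  have "ekw_run (Seq e1 e2, k, w1 @ w2 @ v) (e1, e2 # k, w1 @ w2 @ v)"
    by (auto intro: step_Seq)
  \<comment> \<open>The induction hypothesis for \<open>e1\<close> is used with continuation
    \<open>e2 # k\<close> and leftover input \<open>w2 @ v\<close>; this is why \<open>k\<close> and
    \<open>v\<close> are generalized.\<close>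
  also have "ekw_run \<dots> (Eps, e2 # k, w2 @ v)" by (rule match_Seq.IH)
  also have "ekw_run \<dots> (e2, k, w2 @ v)" by (auto intro: step_Eps)
  also have "ekw_run \<dots> (Eps, k, v)" by (rule match_Seq.IH)
  finally show ?case by simp
next
  case (match_Star_Nil e)
  show ?case by (auto intro: step_Star_Eps)
next
  case (match_Star_step e w1 w2)
  have "ekw_run (Star e, k, w1 @ w2 @ v) (e, Star e # k, w1 @ w2 @ v)"
    by (auto intro: step_Star)
  also have "ekw_run \<dots> (Eps, Star e # k, w2 @ v)" by (rule match_Star_step.IH)
  \<comment> \<open>One iteration is finished; popping \<open>Star e\<close> restores the situation
    of the second induction hypothesis.\<close>
  also have "ekw_run \<dots> (Star e, k, w2 @ v)" by (auto intro: step_Eps)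
  also have "ekw_run \<dots> (Eps, k, v)" by (rule match_Star_step.IH)
  finally show ?case by simp
next
  case (match_Alt1 e1 w e2)
  show ?case by (rule converse_rtranclp_into_rtranclp[OF step_Alt1 match_Alt1.IH])
next
  case (match_Alt2 e2 w e1)
  show ?case by (rule converse_rtranclp_into_rtranclp[OF step_Alt2 match_Alt2.IH])
qed

text \<open>Folding the continuation with \<open>Seq\<close> turns the claim into an ordinary match;
  the closing \<open>Eps\<close> makes the empty continuation a unit.\<close>

definition config_matches :: "'a ekw_config \<Rightarrow> bool" where
  "config_matches c \<longleftrightarrow> (case c of (e, k, w) \<Rightarrow> Seq e (foldr Seq k Eps) \<Down> w)"

lemma config_matches_ekw_step:
  "ekw_step c c' \<Longrightarrow> config_matches c' \<Longrightarrow> config_matches c"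
proof (induction rule: ekw_step.induct)
  case (step_Alt1 e1 e2 k w)
  then show ?case
    unfolding config_matches_def prod.case matches_Seq_iff by (blast intro: match_Alt1)
next
  case (step_Alt2 e1 e2 k w)
  then show ?case
    unfolding config_matches_def prod.case matches_Seq_iff by (blast intro: match_Alt2)
next
  case (step_Seq e1 e2 k w)
  \<comment> \<open>The same three pieces of \<open>w\<close> serve both configurations, bracketed
    differently.\<close>
  then show ?case by (simp add: config_matches_def matches_Seq_iff) (metis append.assoc)
next
  case (step_Star e k w)
  \<comment> \<open>The pieces belong to one iteration, the remaining iterations and the
    continuation; the first two merge into a single match of \<open>Star e\<close>.\<close>
  then obtain w1 w2 w3 where "w = w1 @ w2 @ w3" "e \<Down> w1" "Star e \<Down> w2" "foldr Seq k Eps \<Down> w3"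
    by (auto simp: config_matches_def matches_Seq_iff)
  then show ?case
    using match_Seq[OF match_Star_step, of e w1 w2 "foldr Seq k Eps" w3]
    by (simp add: config_matches_def)
next
  case (step_Star_Eps e k w)
  then show ?case
    using match_Seq[OF match_Star_Nil, of "foldr Seq k Eps" w e]
    by (simp add: config_matches_def matches_Seq_iff[of Eps] matches_Eps_iff)
next
  case (step_Atom a k w)
  \<comment> \<open>\<open>Eps\<close> takes no input, so the continuation matches all of
    \<open>w\<close>, and the consumed letter is put back in front.\<close>
  then show ?case
    using match_Seq[OF match_Atom, of "foldr Seq k Eps" w a]
    by (simp add: config_matches_def matches_Seq_iff[of Eps] matches_Eps_iff)
next
  case (step_Eps e k w)
  then show ?case by (simp add: config_matches_def matches_Seq_iff[of Eps] matches_Eps_iff)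
qed

lemma ekw_run_imp_config_matches:
  "ekw_run c (Eps, [], []) \<Longrightarrow> config_matches c"
proof (induction rule: converse_rtranclp_induct)
  case base
  show ?case by (simp add: config_matches_def matches_Seq_iff matches_Eps_iff)
next
  case (step c c')
  then show ?case by (blast intro: config_matches_ekw_step)
qed

theorem theorem1:
  fixes \<Sigma> :: "'a set" and e :: "'a rexp" and w :: "'a list"
  assumes "finite \<Sigma>" and "atoms e \<subseteq> \<Sigma>" and "w \<in> lists \<Sigma>"
  shows "e \<Down> w \<longleftrightarrow> ekw_run (e, [], w) (Eps, [], [])"
proof
  assume "e \<Down> w"
  then show "ekw_run (e, [], w) (Eps, [], [])"
    using matches_imp_ekw_run[of e w "[]" "[]"] by simp
next
  assume "ekw_run (e, [], w) (Eps, [], [])"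
  then have "config_matches (e, [], w)" by (rule ekw_run_imp_config_matches)
  \<comment> \<open>With an empty continuation only \<open>Eps\<close> follows \<open>e\<close>, so
    \<open>e\<close> accounts for the whole of \<open>w\<close>.\<close>
  then show "e \<Down> w" by (auto simp: config_matches_def matches_Seq_iff matches_Eps_iff)
qed

end
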